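(* Let $n\ge 3$, let $M\ge 1$ and $\bar M=\log M$, let $A\in{\cal P}_n\cap[1/M,M]^{n\times n}$, put $\bar a_{ij}=\log a_{ij}$, and let $K\ge 0$ be an integer. Consider the mixed 0-1 optimization problem in the real variables $\lambda$, $x_{ij}$ ($1\le i,j\le n$), $z_i$ ($1\le i\le n$) and the binary variables $y_{ij}$ ($1\le i<j\le n$): $$\begin{array}{rll} \min & \lambda & \\ \mathrm{s.t.} & \sum_{j=1}^{n} e^{x_{ij}+z_j-z_i}\le \lambda, & i=1,\dots,n,\\ & \sum_{i=1}^{n-1}\sum_{j=i+1}^{n} y_{ij}\le K, & \\ & x_{ij}=-x_{ji}, & 1\le i\le j\le n,\\ & -\bar M\le x_{ij}\le \bar M, & 1\le i<j\le n,\\ & -2\bar M y_{ij}\le x_{ij}-\bar a_{ij}\le 2\bar M y_{ij}, & 1\le i<j\le n,\\ & y_{ij}\in\{0,1\}, & 1\le i<j\le n. \end{array}$$ Denote its optimum value by $\lambda_{\mathrm{opt}}$ and let $\alpha_{\mathrm{opt}}=\dfrac{\lambda_{\mathrm{opt}}-n}{RI_n(n-1)}$. Then $\alpha_{\mathrm{opt}}$ is the minimal value of the inconsistency $CR_n$ that can be obtained by modifying at most $K$ elements above the main diagonal of $A$ (and their reciprocals), i.e. $$\alpha_{\mathrm{opt}}=\min\{\,CR_n(\hat A)\ :\ \hat A\in{\cal P}_n\cap[1/M,M]^{n\times n},\ d(A,\hat A)\le K\,\}.$$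
   Context: ${\cal P}_n$ is the set of $n\times n$ pairwise comparison matrices: real matrices $A=(a_{ij})$ with $a_{ij}>0$ and $a_{ij}=1/a_{ji}$ for all $i,j$ (so $a_{ii}=1$). $[1/M,M]^{n\times n}$ is the set of $n\times n$ matrices all of whose entries lie in $[1/M,M]$. For $A,\hat A\in{\cal P}_n$, $d(A,\hat A)=|\{(i,j):1\le i<j\le n,\ a_{ij}\ne\hat a_{ij}\}|$. For $A\in{\cal P}_n$, $\lambda_{\max}(A)$ is the largest (Perron) eigenvalue of $A$. $RI_n>0$ is a fixed positive real constant depending only on $n$ (in Saaty's definition, $RI_n=(\overline{\lambda_{\max}}-n)/(n-1)$ where $\overline{\lambda_{\max}}$ is the average largest eigenvalue of randomly generated $n\times n$ pairwise comparison matrices). Saaty's inconsistency index is $CR_n(A)=\dfrac{(\lambda_{\max}(A)-n)/(n-1)}{RI_n}$. *)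

theory Defs
  imports Complex_Main "Jordan_Normal_Form.Char_Poly"
begin

text \<open>
  Rows and columns of an \<open>n \<times> n\<close> matrix are indexed by \<open>0, \<dots>, n - 1\<close>, the convention of
  \<^type>\<open>mat\<close>; all index ranges are shifted by one accordingly.
\<close>

definition pairwise_comparison_mats :: "nat \<Rightarrow> real mat set" where
  "pairwise_comparison_mats n =
     {A \<in> carrier_mat n n. \<forall>i<n. \<forall>j<n. A $$ (i, j) > 0 \<and> A $$ (i, j) = 1 / A $$ (j, i)}"

definition box_mats :: "nat \<Rightarrow> real \<Rightarrow> real mat set" where
  "box_mats n M = {A \<in> carrier_mat n n. \<forall>i<n. \<forall>j<n. A $$ (i, j) \<in> {1 / M..M}}"

definition pcm_dist :: "nat \<Rightarrow> real mat \<Rightarrow> real mat \<Rightarrow> nat" where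
  "pcm_dist n A B = card {(i, j). i < j \<and> j < n \<and> A $$ (i, j) \<noteq> B $$ (i, j)}"

text \<open>
  The eigenvalues here are the real ones, among which ``largest'' is meaningful.  For an entrywise
  positive matrix this set is finite and nonempty, and its maximum is the Perron eigenvalue.
\<close>

definition lambda_max :: "real mat \<Rightarrow> real" where
  "lambda_max A = Max {k. eigenvalue A k}"

text \<open>The normalising constants \<open>RI n\<close> are a parameter.\<close>

definition CR :: "(nat \<Rightarrow> real) \<Rightarrow> nat \<Rightarrow> real mat \<Rightarrow> real" where
  "CR RI n A = ((lambda_max A - real n) / (real n - 1)) / RI n"

definition feasible ::
  "nat \<Rightarrow> real \<Rightarrow> real mat \<Rightarrow> nat \<Rightarrow>
   real \<Rightarrow> (nat \<Rightarrow> nat \<Rightarrow> real) \<Rightarrow> (nat \<Rightarrow> real) \<Rightarrow> (nat \<Rightarrow> nat \<Rightarrow> real) \<Rightarrow> bool" where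
  "feasible n M A K l x z y \<longleftrightarrow>
     (\<forall>i<n. (\<Sum>j<n. exp (x i j + z j - z i)) \<le> l) \<and>
     (\<Sum>i<n - 1. \<Sum>j=i + 1..<n. y i j) \<le> real K \<and>
     (\<forall>j<n. \<forall>i\<le>j. x i j = - x j i) \<and>
     (\<forall>j<n. \<forall>i<j. - ln M \<le> x i j \<and> x i j \<le> ln M) \<and>
     (\<forall>j<n. \<forall>i<j. - 2 * ln M * y i j \<le> x i j - ln (A $$ (i, j)) \<and>
                   x i j - ln (A $$ (i, j)) \<le> 2 * ln M * y i j) \<and>
     (\<forall>j<n. \<forall>i<j. y i j \<in> {0, 1})"

definition objective_values :: "nat \<Rightarrow> real \<Rightarrow> real mat \<Rightarrow> nat \<Rightarrow> real set" where
  "objective_values n M A K = {l. \<exists>x z y. feasible n M A K l x z y}"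

definition lambda_opt :: "nat \<Rightarrow> real \<Rightarrow> real mat \<Rightarrow> nat \<Rightarrow> real" where
  "lambda_opt n M A K = Inf (objective_values n M A K)"

definition alpha_opt :: "(nat \<Rightarrow> real) \<Rightarrow> nat \<Rightarrow> real \<Rightarrow> real mat \<Rightarrow> nat \<Rightarrow> real" where
  "alpha_opt RI n M A K = (lambda_opt n M A K - real n) / (RI n * (real n - 1))"

text \<open>
  Unlike \<^const>\<open>Inf\<close> or \<^const>\<open>Min\<close>, this asserts that a minimum is attained, also for
  infinite sets.
\<close>

definition is_minimum :: "real \<Rightarrow> real set \<Rightarrow> bool" where
  "is_minimum m S \<longleftrightarrow> m \<in> S \<and> (\<forall>s\<in>S. m \<le> s)"

end

theory Submission
  imports Defs "HOL-Analysis.Elementary_Metric_Spaces"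
begin

text \<open>
  Substituting \<open>b\<^sub>i\<^sub>j = exp x\<^sub>i\<^sub>j\<close> and \<open>w\<^sub>i = exp z\<^sub>i\<close> turns the
  exponential constraints into \<open>B w \<le> l w\<close> for a positive vector \<open>w\<close>, the skew symmetry and
  the bounds on \<open>x\<close> into \<open>B\<close> being a pairwise comparison matrix with entries in \<open>[1/M, M]\<close>,
  and the binary variables into a count of the altered entries: \<open>y\<^sub>i\<^sub>j = 0\<close> forces
  \<open>b\<^sub>i\<^sub>j = a\<^sub>i\<^sub>j\<close>, while \<open>y\<^sub>i\<^sub>j = 1\<close> imposes nothing beyond the box, because two
  points of \<open>[- ln M, ln M]\<close> are never more than \<open>2 ln M\<close> apart
  (\<open>objective_values_iff\<close>).

  For fixed \<open>B\<close> the least \<open>l\<close> admitting a positive \<open>w\<close> with \<open>B w \<le> l w\<close> is the Perron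
  eigenvalue (Collatz and Wielandt).  On the one hand such a \<open>w\<close> bounds every eigenvalue by
  \<open>l\<close> (\<open>eigenvalue_le_of_subinvariant\<close>).  On the other hand, if \<open>l\<close> is least, then
  \<open>B w = l w\<close>, since otherwise \<open>B w\<close> would be a positive vector on which \<open>l\<close> can be lowered
  (\<open>minimal_subinvariant_is_invariant\<close>).

  Both the optimum of the program and the least \<open>l\<close> for a single \<open>B\<close> exist by one compactness
  argument (\<open>closed_objective_values\<close>): the constraints are closed conditions, and after the
  shift to \<open>z\<^sub>0 = 0\<close> all variables range over a bounded set.  The single matrix is the
  instance with data \<open>B\<close> and budget \<open>0\<close>, whose only admissible matrix is \<open>B\<close>
  itself; so Perron vectors come from the program too (\<open>perron_vector_exists\<close>).  Minimizing over
  \<open>w\<close> and then over \<open>B\<close> shows that the optimum is the least Perron eigenvalue, and \<open>CR\<close> is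
  an increasing affine function of that eigenvalue.
\<close>

section \<open>Subinvariant positive vectors\<close>

text \<open>
  Measure an eigenvector \<open>v\<close> against \<open>w\<close>: at an index \<open>i\<close> where \<open>\<bar>v\<^sub>i\<bar> / w\<^sub>i\<close> is largest,
  the \<open>i\<close>-th row of \<open>B v = k v\<close> is dominated by that ratio times the \<open>i\<close>-th row of
  \<open>B w \<le> l w\<close>.
\<close>

lemma eigenvalue_le_of_subinvariant:
  fixes B :: "real mat" and w :: "nat \<Rightarrow> real"
  assumes B: "B \<in> carrier_mat n n"
    and nonneg: "\<And>i j. i < n \<Longrightarrow> j < n \<Longrightarrow> 0 \<le> B $$ (i, j)"
    and w: "\<And>i. i < n \<Longrightarrow> 0 < w i"
    and sub: "\<And>i. i < n \<Longrightarrow> (\<Sum>j<n. B $$ (i, j) * w j) \<le> l * w i"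
    and ev: "eigenvalue B k"
  shows "k \<le> l"
proof -
  obtain v where v: "v \<in> carrier_vec n" "v \<noteq> 0\<^sub>v n" "B *\<^sub>v v = k \<cdot>\<^sub>v v"
    using ev B unfolding eigenvalue_def eigenvector_def by auto
  have row: "(\<Sum>j<n. B $$ (i, j) * v $ j) = k * v $ i" if "i < n" for i
  proof -
    have "(B *\<^sub>v v) $ i = (\<Sum>j<n. B $$ (i, j) * v $ j)"
      using that B v(1) by (auto simp: scalar_prod_def atLeast0LessThan intro!: sum.cong)
    then show ?thesis using v that by auto
  qed
  obtain p where p: "p < n" "v $ p \<noteq> 0"
    using v(1,2) by (metis carrier_vecD eq_vecI index_zero_vec)
  define r where "r = (\<lambda>i. \<bar>v $ i\<bar> / w i)"
  have "Max (r ` {..<n}) \<in> r ` {..<n}" using p by (intro Max_in) auto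
  then obtain i where i: "i < n" and r_i: "r i = Max (r ` {..<n})" by fastforce
  have r_max: "r j \<le> r i" if "j < n" for j
    unfolding r_i using that by (intro Max_ge) auto
  have "0 < r p" using p w by (simp add: r_def)
  then have "0 < r i" using r_max[OF p(1)] by simp
  then have vi: "0 < \<bar>v $ i\<bar>" using w[OF i] by (simp add: r_def zero_less_divide_iff)
  have entry: "\<bar>v $ j\<bar> \<le> r i * w j" if "j < n" for j
    using r_max[OF that] w[OF that] by (simp add: r_def pos_divide_le_eq)
  have "k * \<bar>v $ i\<bar> \<le> \<bar>k * v $ i\<bar>" by (simp add: abs_mult mult_right_mono)
  also have "\<dots> \<le> (\<Sum>j<n. \<bar>B $$ (i, j) * v $ j\<bar>)"
    unfolding row[OF i, symmetric] by (rule sum_abs)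
  also have "\<dots> \<le> (\<Sum>j<n. B $$ (i, j) * (r i * w j))"
    using nonneg[OF i] entry by (intro sum_mono) (auto simp: abs_mult intro!: mult_left_mono)
  also have "\<dots> = r i * (\<Sum>j<n. B $$ (i, j) * w j)"
    by (simp add: sum_distrib_left mult_ac)
  also have "\<dots> \<le> r i * (l * w i)" using sub[OF i] \<open>0 < r i\<close> by simp
  also have "\<dots> = l * \<bar>v $ i\<bar>" using w[OF i] by (simp add: r_def)
  finally show "k \<le> l" using vi by simp
qed

lemma eigenvalue_of_positive_vector:
  fixes B :: "real mat" and w :: "nat \<Rightarrow> real"
  assumes B: "B \<in> carrier_mat n n" and "0 < n"
    and w: "\<And>i. i < n \<Longrightarrow> 0 < w i"
    and eq: "\<And>i. i < n \<Longrightarrow> (\<Sum>j<n. B $$ (i, j) * w j) = l * w i"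
  shows "eigenvalue B l"
proof -
  have "B *\<^sub>v vec n w = l \<cdot>\<^sub>v vec n w"
    using B eq by (intro eq_vecI) (auto simp: scalar_prod_def atLeast0LessThan)
  moreover have "vec n w \<noteq> 0\<^sub>v n"
    using w[OF \<open>0 < n\<close>] \<open>0 < n\<close> by (metis index_vec index_zero_vec(1) less_irrefl)
  ultimately show ?thesis
    using B unfolding eigenvalue_def eigenvector_def by (intro exI[of _ "vec n w"]) auto
qed

lemma finite_eigenvalues:
  fixes B :: "real mat"
  assumes "B \<in> carrier_mat n n"
  shows "finite {k. eigenvalue B k}"
proof -
  have "char_poly B \<noteq> 0" using degree_monic_char_poly[OF assms] by auto
  then show ?thesis using poly_roots_finite by (simp add: eigenvalue_root_char_poly[OF assms])
qed

lemma lambda_max_eq_of_positive_vector: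
  fixes B :: "real mat" and w :: "nat \<Rightarrow> real"
  assumes B: "B \<in> carrier_mat n n" and "0 < n"
    and nonneg: "\<And>i j. i < n \<Longrightarrow> j < n \<Longrightarrow> 0 \<le> B $$ (i, j)"
    and w: "\<And>i. i < n \<Longrightarrow> 0 < w i"
    and eq: "\<And>i. i < n \<Longrightarrow> (\<Sum>j<n. B $$ (i, j) * w j) = l * w i"
  shows "lambda_max B = l"
  unfolding lambda_max_def
proof (rule Max_eqI)
  show "finite {k. eigenvalue B k}" by (rule finite_eigenvalues[OF B])
  show "l \<in> {k. eigenvalue B k}" using eigenvalue_of_positive_vector[OF B \<open>0 < n\<close> w eq] by simp
  show "k \<le> l" if "k \<in> {k. eigenvalue B k}" for k
    using eigenvalue_le_of_subinvariant[where l = l and k = k, OF B nonneg w] eq that by simp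
qed

text \<open>
  Suppose \<open>B w \<le> l w\<close> with a strict inequality in some row.  As \<open>B\<close> has positive entries, it
  spreads that gap to every row: \<open>u = B w\<close> satisfies \<open>B u < l u\<close> in all of them, so a
  smaller factor than \<open>l\<close> serves for \<open>u\<close>.
\<close>

lemma minimal_subinvariant_is_invariant:
  fixes B :: "real mat" and w :: "nat \<Rightarrow> real"
  assumes pos: "\<And>i j. i < n \<Longrightarrow> j < n \<Longrightarrow> 0 < B $$ (i, j)"
    and w: "\<And>i. i < n \<Longrightarrow> 0 < w i"
    and sub: "\<And>i. i < n \<Longrightarrow> (\<Sum>j<n. B $$ (i, j) * w j) \<le> l * w i"
    and minimal: "\<And>u m. (\<And>i. i < n \<Longrightarrow> 0 < u i) \<Longrightarrow>
      (\<And>i. i < n \<Longrightarrow> (\<Sum>j<n. B $$ (i, j) * u j) \<le> m * u i) \<Longrightarrow> l \<le> m"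
    and i: "i < n"
  shows "(\<Sum>j<n. B $$ (i, j) * w j) = l * w i"
proof (rule ccontr)
  assume neq: "\<not> ?thesis"
  define u where "u = (\<lambda>i. \<Sum>j<n. B $$ (i, j) * w j)"
  have u: "0 < u q" if "q < n" for q
    unfolding u_def using that pos w by (intro sum_pos) auto
  have strict: "(\<Sum>j<n. B $$ (q, j) * u j) < l * u q" if "q < n" for q
  proof -
    have "(\<Sum>j<n. B $$ (q, j) * u j) < (\<Sum>j<n. B $$ (q, j) * (l * w j))"
    proof (rule sum_strict_mono_ex1)
      show "\<forall>j\<in>{..<n}. B $$ (q, j) * u j \<le> B $$ (q, j) * (l * w j)"
        using pos[OF that] sub by (auto simp: u_def less_imp_le intro!: mult_left_mono)
      have "u i < l * w i" using neq sub[OF i] by (simp add: u_def)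
      then show "\<exists>j\<in>{..<n}. B $$ (q, j) * u j < B $$ (q, j) * (l * w j)"
        using i pos[OF that i] by (intro bexI[of _ i]) auto
    qed simp
    also have "\<dots> = l * u q" by (simp add: u_def sum_distrib_left mult_ac)
    finally show ?thesis .
  qed
  \<comment> \<open>The largest quotient is the least factor that serves for \<open>u\<close>; it stays below \<open>l\<close>
    because there are only finitely many rows.\<close>
  define R where "R = (\<lambda>q. (\<Sum>j<n. B $$ (q, j) * u j) / u q) ` {..<n}"
  have R: "finite R" "R \<noteq> {}" using i by (auto simp: R_def)
  have "Max R < l"
    using R strict u by (auto simp: R_def pos_divide_less_eq)
  moreover have "(\<Sum>j<n. B $$ (q, j) * u j) \<le> Max R * u q" if "q < n" for q
  proof -
    have "(\<Sum>j<n. B $$ (q, j) * u j) / u q \<le> Max R" using that by (simp add: R_def)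
    then show ?thesis using u[OF that] by (simp add: pos_divide_le_eq)
  qed
  ultimately show False using minimal[of u "Max R"] u by fastforce
qed

section \<open>Feasible points as matrices with a subinvariant vector\<close>

lemma upper_triangle_sum:
  fixes f :: "nat \<Rightarrow> nat \<Rightarrow> real"
  shows "(\<Sum>i<n - 1. \<Sum>j=i + 1..<n. f i j) = (\<Sum>(i, j)\<in>{(i, j). i < j \<and> j < n}. f i j)"
proof -
  have "{(i, j). i < j \<and> j < n} = (SIGMA i:{..<n - 1}. {i + 1..<n})" by auto
  then show ?thesis by (simp add: sum.Sigma)
qed

lemma finite_upper_triangle: "finite {(i, j). i < j \<and> j < (n::nat)}"
  by (rule finite_subset[of _ "{..<n} \<times> {..<n}"]) auto

lemma pairwise_comparison_matsD:
  assumes "B \<in> pairwise_comparison_mats n"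
  shows pcm_carrier: "B \<in> carrier_mat n n"
    and pcm_pos: "i < n \<Longrightarrow> j < n \<Longrightarrow> 0 < B $$ (i, j)"
    and pcm_recip: "i < n \<Longrightarrow> j < n \<Longrightarrow> B $$ (i, j) = 1 / B $$ (j, i)"
  using assms unfolding pairwise_comparison_mats_def by blast+

lemma box_mats_ln_bounds:
  assumes "B \<in> box_mats n M" "1 \<le> M" "i < n" "j < n"
  shows "- ln M \<le> ln (B $$ (i, j))" "ln (B $$ (i, j)) \<le> ln M"
proof -
  have b: "1 / M \<le> B $$ (i, j)" "B $$ (i, j) \<le> M"
    using assms by (auto simp: box_mats_def)
  have "0 < 1 / M" using assms(2) by simp
  then have "0 < B $$ (i, j)" using b(1) by linarith
  then show "ln (B $$ (i, j)) \<le> ln M" using b(2) by simp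
  have "ln (1 / M) \<le> ln (B $$ (i, j))" using \<open>0 < 1 / M\<close> \<open>0 < B $$ (i, j)\<close> b(1) by simp
  then show "- ln M \<le> ln (B $$ (i, j))" using assms(2) by (simp add: ln_div)
qed

lemma feasibleD:
  assumes "feasible n M A K l x z y"
  shows feasible_row: "i < n \<Longrightarrow> (\<Sum>j<n. exp (x i j + z j - z i)) \<le> l"
    and feasible_budget: "(\<Sum>i<n - 1. \<Sum>j=i + 1..<n. y i j) \<le> real K"
    and feasible_skew: "i \<le> j \<Longrightarrow> j < n \<Longrightarrow> x i j = - x j i"
    and feasible_box: "i < j \<Longrightarrow> j < n \<Longrightarrow> - ln M \<le> x i j \<and> x i j \<le> ln M"
    and feasible_link: "i < j \<Longrightarrow> j < n \<Longrightarrow>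
      - 2 * ln M * y i j \<le> x i j - ln (A $$ (i, j)) \<and>
      x i j - ln (A $$ (i, j)) \<le> 2 * ln M * y i j"
    and feasible_binary: "i < j \<Longrightarrow> j < n \<Longrightarrow> y i j \<in> {0, 1}"
proof -
  note f = assms[unfolded feasible_def]
  note f2 = f[THEN conjunct2]
  note f3 = f2[THEN conjunct2]
  note f4 = f3[THEN conjunct2]
  note f5 = f4[THEN conjunct2]
  show "i < n \<Longrightarrow> (\<Sum>j<n. exp (x i j + z j - z i)) \<le> l" by (rule f[THEN conjunct1, rule_format])
  show "(\<Sum>i<n - 1. \<Sum>j=i + 1..<n. y i j) \<le> real K" by (rule f2[THEN conjunct1])
  show "x i j = - x j i" if "i \<le> j" "j < n"
    by (rule f3[THEN conjunct1, THEN spec, THEN mp, OF that(2), THEN spec, THEN mp, OF that(1)])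
  show "- ln M \<le> x i j \<and> x i j \<le> ln M" if "i < j" "j < n"
    by (rule f4[THEN conjunct1, THEN spec, THEN mp, OF that(2), THEN spec, THEN mp, OF that(1)])
  show "- 2 * ln M * y i j \<le> x i j - ln (A $$ (i, j)) \<and>
      x i j - ln (A $$ (i, j)) \<le> 2 * ln M * y i j" if "i < j" "j < n"
    by (rule f5[THEN conjunct1, THEN spec, THEN mp, OF that(2), THEN spec, THEN mp, OF that(1)])
  show "y i j \<in> {0, 1}" if "i < j" "j < n"
    by (rule f5[THEN conjunct2, THEN spec, THEN mp, OF that(2), THEN spec, THEN mp, OF that(1)])
qed

lemma feasible_entry_bounds:
  assumes feas: "feasible n M A K l x z y" and "i < n" "j < n" and "1 \<le> M"
  shows "- ln M \<le> x i j" "x i j \<le> ln M"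
proof -
  have "0 \<le> ln M" using \<open>1 \<le> M\<close> by simp
  then have "- ln M \<le> x i j \<and> x i j \<le> ln M"
    using feasible_skew[OF feas, of i j] feasible_skew[OF feas, of j i]
      feasible_box[OF feas, of i j] feasible_box[OF feas, of j i] assms(2,3)
    by (cases i j rule: linorder_cases) auto
  then show "- ln M \<le> x i j" "x i j \<le> ln M" by auto
qed

text \<open>
  The logarithmic change of variables, with the auxiliary variables eliminated.
  Given \<open>B\<close> and \<open>w\<close>, the binary variables are chosen to mark exactly the entries where \<open>B\<close>
  differs from \<open>A\<close>.
\<close>

lemma objective_values_iff:
  assumes M: "1 \<le> M" and A: "A \<in> pairwise_comparison_mats n \<inter> box_mats n M"
  shows "l \<in> objective_values n M A K \<longleftrightarrow>
    (\<exists>B w. B \<in> pairwise_comparison_mats n \<inter> box_mats n M \<and> pcm_dist n A B \<le> K \<and>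
      (\<forall>i<n. 0 < w i) \<and> (\<forall>i<n. (\<Sum>j<n. B $$ (i, j) * w j) \<le> l * w i))"
    (is "_ \<longleftrightarrow> ?R")
proof
  assume "l \<in> objective_values n M A K"
  then obtain x z y where feas: "feasible n M A K l x z y"
    unfolding objective_values_def by blast
  define B where "B = mat n n (\<lambda>(i, j). exp (x i j))"
  have Bij: "B $$ (i, j) = exp (x i j)" if "i < n" "j < n" for i j
    using that by (simp add: B_def)
  have skew: "x i j = - x j i" if "i < n" "j < n" for i j
    using feasible_skew[OF feas, of i j] feasible_skew[OF feas, of j i] that
    by (cases "i \<le> j") auto
  have recip: "exp (x i j) = 1 / exp (x j i)" if "i < n" "j < n" for i j
    unfolding skew[OF that] by (simp add: exp_minus inverse_eq_divide)
  have "0 < B $$ (i, j) \<and> B $$ (i, j) = 1 / B $$ (j, i)" if "i < n" "j < n" for i j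
    unfolding Bij[OF that] Bij[OF that(2,1)] by (intro conjI exp_gt_zero recip that)
  moreover have "B \<in> carrier_mat n n" by (simp add: B_def)
  ultimately have "B \<in> pairwise_comparison_mats n"
    unfolding pairwise_comparison_mats_def by blast
  moreover have "B \<in> box_mats n M"
  proof -
    have "1 / M \<le> exp (x i j) \<and> exp (x i j) \<le> M" if "i < n" "j < n" for i j
    proof -
      have "exp (- ln M) \<le> exp (x i j)" "exp (x i j) \<le> exp (ln M)"
        using feasible_entry_bounds[OF feas that M] by simp_all
      then show ?thesis using M by (simp add: exp_minus inverse_eq_divide)
    qed
    then show ?thesis by (auto simp: box_mats_def B_def)
  qed
  moreover have "pcm_dist n A B \<le> K"
  proof -
    let ?T = "{(i, j). i < j \<and> j < n}"
    let ?D = "{(i, j). i < j \<and> j < n \<and> A $$ (i, j) \<noteq> B $$ (i, j)}"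
    have y01: "y i j = 0 \<or> y i j = 1" if "i < j" "j < n" for i j
      using feasible_binary[OF feas that] by blast
    have y1: "y i j = 1" if "i < j" "j < n" "A $$ (i, j) \<noteq> B $$ (i, j)" for i j
    proof (rule ccontr)
      assume "y i j \<noteq> 1"
      then have "y i j = 0" using y01 that by blast
      then have "x i j = ln (A $$ (i, j))"
        using feasible_link[OF feas that(1,2)] by simp
      moreover have "0 < A $$ (i, j)"
        using A that pcm_pos[of A n i j] by simp
      ultimately show False using that Bij[of i j] by simp
    qed
    have "real (card ?D) = (\<Sum>(i, j)\<in>?D. y i j)"
      using y1 by (simp add: case_prod_beta)
    also have "\<dots> \<le> (\<Sum>(i, j)\<in>?T. y i j)"
    proof (rule sum_mono2)
      show "finite ?T" by (rule finite_upper_triangle)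
      show "?D \<subseteq> ?T" by auto
      show "0 \<le> (case p of (i, j) \<Rightarrow> y i j)" if p: "p \<in> ?T - ?D" for p
      proof -
        obtain i j where "p = (i, j)" "i < j" "j < n" using p by auto
        then show ?thesis using y01[of i j] by auto
      qed
    qed
    also have "\<dots> \<le> real K"
      using feasible_budget[OF feas] unfolding upper_triangle_sum .
    finally show ?thesis unfolding pcm_dist_def by simp
  qed
  moreover have "(\<Sum>j<n. B $$ (i, j) * exp (z j)) \<le> l * exp (z i)" if "i < n" for i
  proof -
    have "(\<Sum>j<n. B $$ (i, j) * exp (z j)) = (\<Sum>j<n. exp (x i j + z j - z i)) * exp (z i)"
      unfolding sum_distrib_right using that
      by (intro sum.cong) (auto simp: Bij simp flip: exp_add)
    also have "\<dots> \<le> l * exp (z i)"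
      using feasible_row[OF feas that] by simp
    finally show ?thesis .
  qed
  ultimately show ?R by (intro exI[of _ B] exI[of _ "\<lambda>i. exp (z i)"]) auto
next
  assume ?R
  then obtain B w where B: "B \<in> pairwise_comparison_mats n" "B \<in> box_mats n M"
    and dist: "pcm_dist n A B \<le> K" and w: "\<And>i. i < n \<Longrightarrow> 0 < w i"
    and sub: "\<And>i. i < n \<Longrightarrow> (\<Sum>j<n. B $$ (i, j) * w j) \<le> l * w i"
    by blast
  have pos: "0 < B $$ (i, j)" and recip: "B $$ (i, j) = 1 / B $$ (j, i)"
    if "i < n" "j < n" for i j
    using that by (auto intro: pcm_pos[OF B(1)] pcm_recip[OF B(1)])
  define x where "x = (\<lambda>i j. ln (B $$ (i, j)))"
  define z where "z = (\<lambda>i. ln (w i))"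
  define y where "y = (\<lambda>i j. if A $$ (i, j) \<noteq> B $$ (i, j) then 1 else 0 :: real)"
  have "(\<Sum>j<n. exp (x i j + z j - z i)) \<le> l" if i: "i < n" for i
  proof -
    have "(\<Sum>j<n. exp (x i j + z j - z i)) = (\<Sum>j<n. B $$ (i, j) * w j) / w i"
      unfolding sum_divide_distrib using i w pos
      by (intro sum.cong) (auto simp: x_def z_def exp_add exp_diff)
    then show ?thesis using sub[OF i] w[OF i] by (simp add: pos_divide_le_eq)
  qed
  moreover have "(\<Sum>i<n - 1. \<Sum>j=i + 1..<n. y i j) \<le> real K"
  proof -
    let ?T = "{(i, j). i < j \<and> j < n}"
    have "?T \<inter> {p. A $$ p \<noteq> B $$ p} = {(i, j). i < j \<and> j < n \<and> A $$ (i, j) \<noteq> B $$ (i, j)}"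
      by auto
    moreover have "(\<Sum>(i, j)\<in>?T. y i j) = (\<Sum>p\<in>?T. if A $$ p \<noteq> B $$ p then 1 else 0)"
      by (intro sum.cong) (auto simp: y_def)
    ultimately have "(\<Sum>(i, j)\<in>?T. y i j) = real (pcm_dist n A B)"
      unfolding pcm_dist_def using finite_upper_triangle[of n]
      by (simp only: sum.If_cases) simp
    then show ?thesis using dist unfolding upper_triangle_sum by simp
  qed
  moreover have "x i j = - x j i" if "j < n" "i \<le> j" for i j
    using that recip[of i j] pos[of j i] by (simp add: x_def ln_div)
  moreover have "- ln M \<le> x i j \<and> x i j \<le> ln M" if "j < n" "i < j" for i j
    using box_mats_ln_bounds[OF B(2) M] that by (simp add: x_def)
  moreover have "- 2 * ln M * y i j \<le> x i j - ln (A $$ (i, j)) \<and>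
      x i j - ln (A $$ (i, j)) \<le> 2 * ln M * y i j" if "j < n" "i < j" for i j
  proof -
    have "A \<in> box_mats n M" using A by simp
    from box_mats_ln_bounds[OF this M, of i j] box_mats_ln_bounds[OF B(2) M, of i j] that
    show ?thesis by (simp add: x_def y_def)
  qed
  moreover have "y i j \<in> {0, 1}" for i j by (simp add: y_def)
  ultimately have "feasible n M A K l x z y" unfolding feasible_def by blast
  then show "l \<in> objective_values n M A K" unfolding objective_values_def by blast
qed

section \<open>Attainment of the optimum\<close>

text \<open>Bolzano and Weierstrass for finitely many coordinates, thinning out one after the other.\<close>

lemma simultaneous_convergent_subsequence:
  fixes f :: "nat \<Rightarrow> 'i \<Rightarrow> real"
  assumes "finite I" and "\<And>i. i \<in> I \<Longrightarrow> Bseq (\<lambda>k. f k i)"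
  obtains r :: "nat \<Rightarrow> nat" and L :: "'i \<Rightarrow> real"
  where "strict_mono r" "\<And>i. i \<in> I \<Longrightarrow> (\<lambda>k. f (r k) i) \<longlonglongrightarrow> L i"
proof -
  have "\<exists>r :: nat \<Rightarrow> nat. strict_mono r \<and> (\<forall>i\<in>I. convergent (\<lambda>k. f (r k) i))"
    using assms
  proof (induction I rule: finite_induct)
    case empty
    show ?case by (rule exI[of _ id]) (simp add: strict_mono_def)
  next
    case (insert a I)
    then obtain r :: "nat \<Rightarrow> nat" where r: "strict_mono r" "\<And>i. i \<in> I \<Longrightarrow> convergent (\<lambda>k. f (r k) i)"
      by blast
    obtain s :: "nat \<Rightarrow> nat" where s: "strict_mono s" "monoseq (\<lambda>k. f (r (s k)) a)"
      using seq_monosub[of "\<lambda>k. f (r k) a"] by blast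
    have "Bseq (\<lambda>k. f (r (s k)) a)"
      using Bseq_subseq[of "\<lambda>k. f k a" "\<lambda>k. r (s k)"] insert.prems[of a] by simp
    then have "convergent (\<lambda>k. f (r (s k)) a)" using s(2) Bseq_monoseq_convergent by blast
    moreover have "convergent (\<lambda>k. f (r (s k)) i)" if "i \<in> I" for i
      using convergent_subseq_convergent[OF r(2)[OF that] s(1)] by (simp add: o_def)
    ultimately show ?case
      using strict_mono_compose[OF r(1) s(1)] by (intro exI[of _ "\<lambda>k. r (s k)"]) (auto simp: o_def)
  qed
  then show ?thesis using that unfolding convergent_def by metis
qed

text \<open>Only the differences of the \<open>z\<^sub>i\<close> matter; pinning one of them makes all of them bounded.\<close>

lemma feasible_normalize:
  assumes "feasible n M A K l x z y"
  shows "feasible n M A K l x (\<lambda>i. z i - z 0) y"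
proof -
  have "x i j + (z j - z 0) - (z i - z 0) = x i j + z j - z i" for i j by simp
  then show ?thesis using assms unfolding feasible_def by presburger
qed

text \<open>
  A single summand of a row is at most \<open>l\<close>.  This confines the differences of the \<open>z\<^sub>i\<close>, which
  have no explicit bounds in the program.
\<close>

lemma feasible_exponent_bound:
  assumes feas: "feasible n M A K l x z y" and M: "1 \<le> M" and ij: "i < n" "j < n"
  shows "0 < l" "z j - z i \<le> ln l + ln M"
proof -
  have "exp (x i j + z j - z i) \<le> (\<Sum>j<n. exp (x i j + z j - z i))"
    using ij by (intro member_le_sum) auto
  also have "\<dots> \<le> l" using feasible_row[OF feas ij(1)] .
  finally have le: "exp (x i j + z j - z i) \<le> l" .
  show "0 < l" using less_le_trans[OF exp_gt_zero le] .
  then have "x i j + z j - z i \<le> ln l" using le by (simp add: ln_ge_iff)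
  then show "z j - z i \<le> ln l + ln M" using feasible_entry_bounds[OF feas ij M] by linarith
qed

text \<open>
  If objective values converge, they are bounded, hence so are the normalized feasible points that
  realize them.  A convergent subsequence of these points has a feasible limit, because every
  constraint is a weak inequality, an equation or membership in the closed set \<open>{0, 1}\<close>.
\<close>

lemma closed_objective_values:
  assumes M: "1 \<le> M" and n: "0 < n"
  shows "closed (objective_values n M A K)"
  unfolding closed_sequential_limits
proof (intro allI impI, elim conjE)
  fix s l
  assume "\<forall>k. s k \<in> objective_values n M A K" and lim: "s \<longlonglongrightarrow> l"
  then have "\<forall>k. \<exists>x z y. feasible n M A K (s k) x z y \<and> z 0 = 0"
    unfolding objective_values_def using feasible_normalize by fastforce
  then obtain x z y where feas: "\<And>k. feasible n M A K (s k) (x k) (z k) (y k)"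
    and z0: "\<And>k. z k 0 = 0" by metis
  obtain C where C: "\<And>k. s k \<le> C"
    using lim convergentI convergent_imp_Bseq by (metis BseqD abs_le_D1 real_norm_def)
  have sC: "ln (s k) \<le> ln C" for k
    using feasible_exponent_bound(1)[OF feas[of k] M n n] C[of k] by simp
  \<comment> \<open>All variables in one family, tagged by \<open>t\<close>, so that a single extraction serves them all.
    The unconstrained \<open>y i j\<close> with \<open>j \<le> i\<close> need not be bounded and are replaced by \<open>0\<close>.\<close>
  define f where "f = (\<lambda>k (t::nat, i, j).
    if t = 0 then x k i j else if t = 1 then z k i else if i < j then y k i j else 0)"
  define I where "I = {..<3::nat} \<times> {..<n} \<times> {..<n}"
  have "Bseq (\<lambda>k. f k p)" if "p \<in> I" for p
  proof -
    obtain t i j where p: "p = (t, i, j)" "i < n" "j < n" using \<open>p \<in> I\<close> by (cases p) (auto simp: I_def)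
    have "\<bar>x k i j\<bar> \<le> ln M" for k
      using feasible_entry_bounds[OF feas[of k] p(2,3) M] by (auto simp: abs_le_iff)
    moreover have "\<bar>z k i\<bar> \<le> ln C + ln M" for k
      using feasible_exponent_bound(2)[OF feas[of k] M p(2) n]
        feasible_exponent_bound(2)[OF feas[of k] M n p(2)] sC[of k] z0[of k]
      by (auto simp: abs_le_iff)
    moreover have "\<bar>if i < j then y k i j else 0\<bar> \<le> 1" for k
    proof -
      have "i < j \<Longrightarrow> y k i j \<in> {0, 1}" using feasible_binary[OF feas[of k]] p by blast
      then show ?thesis by auto
    qed
    ultimately show ?thesis
      by (intro BseqI'[where K = "max (ln M) (max (ln C + ln M) 1)"])
        (auto simp: f_def p le_max_iff_disj)
  qed
  moreover have "finite I" by (simp add: I_def)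
  ultimately obtain r L where r: "strict_mono r"
    and L: "\<And>p. p \<in> I \<Longrightarrow> (\<lambda>k. f (r k) p) \<longlonglongrightarrow> L p"
    using simultaneous_convergent_subsequence[of I f] by blast
  define X where "X = (\<lambda>i j. L (0, i, j))"
  define Z where "Z = (\<lambda>i. L (1, i, 0))"
  define Y where "Y = (\<lambda>i j. L (2, i, j))"
  have x_lim: "(\<lambda>k. x (r k) i j) \<longlonglongrightarrow> X i j" if "i < n" "j < n" for i j
    using L[of "(0, i, j)"] that by (simp add: I_def f_def X_def)
  have z_lim: "(\<lambda>k. z (r k) i) \<longlonglongrightarrow> Z i" if "i < n" for i
    using L[of "(1, i, 0)"] that n by (simp add: I_def f_def Z_def)
  have y_lim: "(\<lambda>k. y (r k) i j) \<longlonglongrightarrow> Y i j" if "i < j" "j < n" for i j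
    using L[of "(2, i, j)"] that by (simp add: I_def f_def Y_def)
  have s_lim: "(\<lambda>k. s (r k)) \<longlonglongrightarrow> l" using LIMSEQ_subseq_LIMSEQ[OF lim r] by (simp add: o_def)
  have fk: "feasible n M A K (s (r k)) (x (r k)) (z (r k)) (y (r k))" for k using feas .
  have "feasible n M A K l X Z Y"
    unfolding feasible_def
  proof (intro conjI allI impI)
    fix i assume i: "i < n"
    have "(\<lambda>k. \<Sum>j<n. exp (x (r k) i j + z (r k) j - z (r k) i))
        \<longlonglongrightarrow> (\<Sum>j<n. exp (X i j + Z j - Z i))"
      using i by (intro tendsto_intros x_lim z_lim) auto
    moreover have "(\<Sum>j<n. exp (x (r k) i j + z (r k) j - z (r k) i)) \<le> s (r k)" for k
      by (rule feasible_row[OF fk i])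
    ultimately show "(\<Sum>j<n. exp (X i j + Z j - Z i)) \<le> l"
      by (blast intro: LIMSEQ_le[OF _ s_lim])
  next
    have "(\<lambda>k. \<Sum>i<n - 1. \<Sum>j=i + 1..<n. y (r k) i j)
        \<longlonglongrightarrow> (\<Sum>i<n - 1. \<Sum>j=i + 1..<n. Y i j)"
      by (intro tendsto_intros y_lim) auto
    moreover have "(\<Sum>i<n - 1. \<Sum>j=i + 1..<n. y (r k) i j) \<le> real K" for k
      by (rule feasible_budget[OF fk])
    ultimately show "(\<Sum>i<n - 1. \<Sum>j=i + 1..<n. Y i j) \<le> real K"
      by (intro LIMSEQ_le_const2[of _ _ "real K"]) blast+
  next
    fix i j assume ij: "j < n" "i \<le> j"
    then have i: "i < n" by simp
    have "(\<lambda>k. x (r k) i j) \<longlonglongrightarrow> - X j i"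
      unfolding feasible_skew[OF fk ij(2,1)] by (intro tendsto_minus x_lim ij i)
    then show "X i j = - X j i" by (rule LIMSEQ_unique[OF x_lim[OF i ij(1)]])
  next
    fix i j assume ij: "j < n" "i < j"
    then have i: "i < n" by simp
    have b: "- ln M \<le> x (r k) i j" "x (r k) i j \<le> ln M"
      "- 2 * ln M * y (r k) i j \<le> x (r k) i j - ln (A $$ (i, j))"
      "x (r k) i j - ln (A $$ (i, j)) \<le> 2 * ln M * y (r k) i j"
      "y (r k) i j \<in> {0, 1}" for k
      using feasible_box[OF fk ij(2,1)] feasible_link[OF fk ij(2,1)] feasible_binary[OF fk ij(2,1)]
      by blast+
    note xl = x_lim[OF i ij(1)] and yl = y_lim[OF ij(2,1)]
    show "- ln M \<le> X i j" using b(1) by (intro LIMSEQ_le_const[OF xl]) auto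
    show "X i j \<le> ln M" using b(2) by (intro LIMSEQ_le_const2[OF xl]) auto
    show "- 2 * ln M * Y i j \<le> X i j - ln (A $$ (i, j))"
      by (rule LIMSEQ_le[OF tendsto_mult[OF tendsto_const yl] tendsto_diff[OF xl tendsto_const]])
        (use b(3) in blast)
    show "X i j - ln (A $$ (i, j)) \<le> 2 * ln M * Y i j"
      by (rule LIMSEQ_le[OF tendsto_diff[OF xl tendsto_const] tendsto_mult[OF tendsto_const yl]])
        (use b(4) in blast)
    show "Y i j \<in> {0, 1}"
      by (rule closed_sequentially[OF _ _ yl]) (use b(5) in auto)
  qed
  then show "l \<in> objective_values n M A K" unfolding objective_values_def by blast
qed

text \<open>
  The matrix \<open>A\<close> with the constant vector \<open>1\<close> shows that the program is feasible: its largest row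
  sum is an objective value.
\<close>

lemma lambda_opt_is_minimum:
  assumes M: "1 \<le> M" and n: "0 < n" and A: "A \<in> pairwise_comparison_mats n \<inter> box_mats n M"
  shows "is_minimum (lambda_opt n M A K) (objective_values n M A K)"
proof -
  let ?S = "objective_values n M A K"
  define l where "l = Max ((\<lambda>i. \<Sum>j<n. A $$ (i, j)) ` {..<n})"
  have "(\<Sum>j<n. A $$ (i, j) * 1) \<le> l * 1" if "i < n" for i
    using that by (simp add: l_def)
  moreover have "pcm_dist n A A \<le> K" by (simp add: pcm_dist_def)
  ultimately have "l \<in> ?S"
    unfolding objective_values_iff[OF M A] using A
    by (intro exI[of _ A] exI[of _ "\<lambda>_. 1"]) auto
  moreover have bdd: "bdd_below ?S"
    using feasible_exponent_bound(1)[OF _ M n n] unfolding objective_values_def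
    by (intro bdd_belowI[of _ 0]) (blast intro: less_imp_le)
  ultimately have "Inf ?S \<in> ?S"
    using closed_objective_values[OF M n] by (intro closed_contains_Inf) auto
  then show ?thesis
    unfolding is_minimum_def lambda_opt_def using cInf_lower[OF _ bdd] by blast
qed

section \<open>The optimum as a least Perron eigenvalue\<close>

lemma pcm_dist_zero_imp_eq:
  assumes A: "A \<in> pairwise_comparison_mats n" and B: "B \<in> pairwise_comparison_mats n"
    and dist: "pcm_dist n A B = 0"
  shows "A = B"
proof -
  have "finite {(i, j). i < j \<and> j < n \<and> A $$ (i, j) \<noteq> B $$ (i, j)}"
    by (rule finite_subset[OF _ finite_upper_triangle[of n]]) auto
  then have upper: "A $$ (i, j) = B $$ (i, j)" if "i < j" "j < n" for i j
    using dist that unfolding pcm_dist_def by auto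
  have diag: "C $$ (i, i) = 1" if "C \<in> pairwise_comparison_mats n" "i < n" for C i
  proof -
    have "0 < C $$ (i, i)" "C $$ (i, i) = 1 / C $$ (i, i)"
      using that by (auto intro: pcm_pos pcm_recip)
    then have "C $$ (i, i) * C $$ (i, i) = 1" by (metis nonzero_eq_divide_eq less_irrefl)
    then show ?thesis using \<open>0 < C $$ (i, i)\<close> by (simp add: square_eq_1_iff)
  qed
  have "A $$ (i, j) = B $$ (i, j)" if "i < n" "j < n" for i j
    using upper[of i j] upper[of j i] diag[OF A] diag[OF B] pcm_recip[OF A that] pcm_recip[OF B that] that
    by (cases i j rule: linorder_cases) auto
  then show ?thesis
    using pcm_carrier[OF A] pcm_carrier[OF B] by (intro eq_matI) auto
qed

text \<open>
  With data \<open>B\<close> and budget \<open>0\<close> the program varies only the vector \<open>w\<close>, so its attained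
  optimum is the least \<open>l\<close> with \<open>B w \<le> l w\<close> for some positive \<open>w\<close>.  By minimality
  \<open>w\<close> is an eigenvector, and its eigenvalue dominates all others.
\<close>

lemma perron_vector_exists:
  assumes M: "1 \<le> M" and n: "0 < n" and B: "B \<in> pairwise_comparison_mats n \<inter> box_mats n M"
  obtains w where "\<And>i. i < n \<Longrightarrow> 0 < w i"
    and "\<And>i. i < n \<Longrightarrow> (\<Sum>j<n. B $$ (i, j) * w j) = lambda_max B * w i"
proof -
  let ?S = "objective_values n M B 0"
  have S: "m \<in> ?S \<longleftrightarrow> (\<exists>w. (\<forall>i<n. 0 < w i) \<and> (\<forall>i<n. (\<Sum>j<n. B $$ (i, j) * w j) \<le> m * w i))" for m
  proof -
    have "B' = B" if "B' \<in> pairwise_comparison_mats n" "pcm_dist n B B' \<le> 0" for B'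
      using pcm_dist_zero_imp_eq[of B n B'] B that by simp
    moreover have "pcm_dist n B B \<le> 0" by (simp add: pcm_dist_def)
    ultimately show ?thesis unfolding objective_values_iff[OF M B] using B by blast
  qed
  define l where "l = lambda_opt n M B 0"
  have l: "l \<in> ?S" "\<And>m. m \<in> ?S \<Longrightarrow> l \<le> m"
    using lambda_opt_is_minimum[OF M n B, of 0] unfolding is_minimum_def l_def by blast+
  obtain w where w: "\<And>i. i < n \<Longrightarrow> 0 < w i"
    and sub: "\<And>i. i < n \<Longrightarrow> (\<Sum>j<n. B $$ (i, j) * w j) \<le> l * w i"
    using l(1) unfolding S by blast
  have pos: "0 < B $$ (i, j)" if "i < n" "j < n" for i j
    using B that by (blast intro: pcm_pos)
  have minimal: "l \<le> m" if "\<And>i. i < n \<Longrightarrow> 0 < u i"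
    "\<And>i. i < n \<Longrightarrow> (\<Sum>j<n. B $$ (i, j) * u j) \<le> m * u i" for u m
    using l(2)[of m] that unfolding S by blast
  have inv: "(\<Sum>j<n. B $$ (i, j) * w j) = l * w i" if "i < n" for i
    using minimal_subinvariant_is_invariant[of n B w l i, OF pos w sub minimal that] .
  have "lambda_max B = l"
  proof (rule lambda_max_eq_of_positive_vector[OF _ n _ w inv])
    show "B \<in> carrier_mat n n" using B by (blast intro: pcm_carrier)
  qed (use pos in \<open>auto intro: less_imp_le\<close>)
  then show thesis using that w inv by blast
qed

text \<open>
  Every eigenvalue is at most \<open>l\<close>; a Perron vector is needed to know that
  \<^term>\<open>lambda_max B\<close> is an eigenvalue at all.
\<close>

lemma lambda_max_le_of_subinvariant:
  assumes M: "1 \<le> M" and n: "0 < n" and B: "B \<in> pairwise_comparison_mats n \<inter> box_mats n M"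
    and w: "\<And>i. i < n \<Longrightarrow> 0 < w i"
    and sub: "\<And>i. i < n \<Longrightarrow> (\<Sum>j<n. B $$ (i, j) * w j) \<le> l * w i"
  shows "lambda_max B \<le> l"
proof -
  have carrier: "B \<in> carrier_mat n n" using B by (blast intro: pcm_carrier)
  have nonneg: "0 \<le> B $$ (i, j)" if "i < n" "j < n" for i j
    using B that by (blast intro: less_imp_le pcm_pos)
  obtain u where u: "\<And>i. i < n \<Longrightarrow> 0 < u i"
    "\<And>i. i < n \<Longrightarrow> (\<Sum>j<n. B $$ (i, j) * u j) = lambda_max B * u i"
    using perron_vector_exists[OF M n B] by blast
  show ?thesis
    using eigenvalue_le_of_subinvariant[OF carrier nonneg w sub]
      eigenvalue_of_positive_vector[OF carrier n u] by blast
qed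

text \<open>
  A Perron vector of an admissible \<open>B\<close> makes its Perron eigenvalue an objective value; conversely
  the matrix of an optimal point has Perron eigenvalue at most the optimum.
\<close>

lemma lambda_opt_is_least_lambda_max:
  assumes M: "1 \<le> M" and n: "0 < n" and A: "A \<in> pairwise_comparison_mats n \<inter> box_mats n M"
  shows "is_minimum (lambda_opt n M A K)
    (lambda_max ` {B \<in> pairwise_comparison_mats n \<inter> box_mats n M. pcm_dist n A B \<le> K})"
proof -
  let ?C = "{B \<in> pairwise_comparison_mats n \<inter> box_mats n M. pcm_dist n A B \<le> K}"
  let ?l = "lambda_opt n M A K"
  have opt: "?l \<in> objective_values n M A K"
    "\<And>m. m \<in> objective_values n M A K \<Longrightarrow> ?l \<le> m"
    using lambda_opt_is_minimum[OF M n A, of K] unfolding is_minimum_def by blast+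
  have lower: "?l \<le> lambda_max B" if "B \<in> ?C" for B
  proof -
    have "B \<in> pairwise_comparison_mats n \<inter> box_mats n M" using that by simp
    then obtain w where "\<And>i. i < n \<Longrightarrow> 0 < w i"
      "\<And>i. i < n \<Longrightarrow> (\<Sum>j<n. B $$ (i, j) * w j) = lambda_max B * w i"
      using perron_vector_exists[OF M n] by metis
    then have "lambda_max B \<in> objective_values n M A K"
      unfolding objective_values_iff[OF M A] using that
      by (intro exI[of _ B] exI[of _ w]) auto
    then show ?thesis by (rule opt(2))
  qed
  obtain B w where B: "B \<in> ?C" and w: "\<And>i. i < n \<Longrightarrow> 0 < w i"
    and sub: "\<And>i. i < n \<Longrightarrow> (\<Sum>j<n. B $$ (i, j) * w j) \<le> ?l * w i"
    using opt(1) unfolding objective_values_iff[OF M A] by blast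
  have "lambda_max B \<le> ?l"
    using lambda_max_le_of_subinvariant[OF M n _ w sub] B by blast
  then have "lambda_max B = ?l" using lower[OF B] by simp
  then show ?thesis unfolding is_minimum_def using B lower by force
qed

text \<open>
  \<^const>\<open>CR\<close> and \<^const>\<open>alpha_opt\<close> apply the same increasing affine map to \<open>\<lambda>\<^sub>m\<^sub>a\<^sub>x\<close> and to
  the optimum, and such a map carries minima to minima.
\<close>

theorem theorem3:
  fixes n K :: nat and M :: real and A :: "real mat" and RI :: "nat \<Rightarrow> real"
  assumes "n \<ge> 3" and "M \<ge> 1" and "RI n > 0"
    and "A \<in> pairwise_comparison_mats n \<inter> box_mats n M"
  shows "is_minimum (lambda_opt n M A K) (objective_values n M A K) \<and>
         is_minimum (alpha_opt RI n M A K)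
           {CR RI n B | B. B \<in> pairwise_comparison_mats n \<inter> box_mats n M \<and> pcm_dist n A B \<le> K}"
proof
  have n: "0 < n" using assms(1) by simp
  show "is_minimum (lambda_opt n M A K) (objective_values n M A K)"
    by (rule lambda_opt_is_minimum[OF assms(2) n assms(4)])
  define g where "g = (\<lambda>l. ((l - real n) / (real n - 1)) / RI n)"
  have "mono g"
    using assms(1,3) by (auto simp: g_def intro!: monoI divide_right_mono)
  moreover have "alpha_opt RI n M A K = g (lambda_opt n M A K)"
    by (simp add: alpha_opt_def g_def mult.commute)
  moreover have "CR RI n = (\<lambda>B. g (lambda_max B))"
    by (simp add: fun_eq_iff CR_def g_def)
  ultimately show "is_minimum (alpha_opt RI n M A K)
      {CR RI n B | B. B \<in> pairwise_comparison_mats n \<inter> box_mats n M \<and> pcm_dist n A B \<le> K}"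
    using lambda_opt_is_least_lambda_max[OF assms(2) n assms(4), of K]
    unfolding is_minimum_def by (auto dest: monoD)
qed

end
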